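(* Let $m,n$ be positive integers. For all nonnegative integers $p$ and $q$, $$[u^pv^q]\,\mathcal N_{m,n}(u,v)=\binom mp\binom np\binom mq\binom nq-\binom{m+1}{p+1}\binom{n-1}{p-1}\binom{m-1}{q-1}\binom{n+1}{q+1},$$ where $\binom ab=0$ whenever $b<0$ or $b>a$.
   Context: For a positive integer $k$, $[k]=\{1<\cdots<k\}$ is the $k$-element chain, and $[2]\times[m]\times[n]$ carries the componentwise order. For an antichain $A\subseteq[2]\times[m]\times[n]$ (set of pairwise incomparable elements, possibly empty) write $A_1=A\cap(\{1\}\times[m]\times[n])$ and $A_2=A\cap(\{2\}\times[m]\times[n])$. The layer-refined antichain polynomial is $\mathcal N_{m,n}(u,v)=\sum_{A}u^{|A_1|}v^{|A_2|}$, the sum over all antichains $A$ of $[2]\times[m]\times[n]$. $[u^pv^q]$ denotes coefficient extraction. *)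

theory Defs
  imports "HOL-Computational_Algebra.Polynomial" "HOL-Library.Product_Order"
begin

text \<open>The order on \<^typ>\<open>nat \<times> nat \<times> nat\<close> is the componentwise one of
  \<^theory>\<open>HOL-Library.Product_Order\<close>.\<close>

definition chain_product :: "nat \<Rightarrow> nat \<Rightarrow> (nat \<times> nat \<times> nat) set" where
  "chain_product m n = {1..2} \<times> {1..m} \<times> {1..n}"

definition antichains :: "'a::order set \<Rightarrow> 'a set set" where
  "antichains P = {A. A \<subseteq> P \<and> pairwise (\<lambda>x y. \<not> x \<le> y \<and> \<not> y \<le> x) A}"

definition layer :: "nat \<Rightarrow> nat \<Rightarrow> nat \<Rightarrow> (nat \<times> nat \<times> nat) set \<Rightarrow> (nat \<times> nat \<times> nat) set" where
  "layer i m n A = A \<inter> ({i} \<times> {1..m} \<times> {1..n})"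

text \<open>A polynomial over the integers in two indeterminates \<open>u\<close> and \<open>v\<close> is represented as a
  polynomial in \<open>v\<close> whose coefficients are polynomials in \<open>u\<close>.\<close>

definition var_u :: "int poly poly" where
  "var_u = [:[:0, 1:]:]"

definition var_v :: "int poly poly" where
  "var_v = [:0, 1:]"

definition coeff_uv :: "int poly poly \<Rightarrow> nat \<Rightarrow> nat \<Rightarrow> int" where
  "coeff_uv F p q = coeff (coeff F q) p"

definition antichain_poly :: "nat \<Rightarrow> nat \<Rightarrow> int poly poly" where
  "antichain_poly m n =
     (\<Sum>A \<in> antichains (chain_product m n).
        var_u ^ card (layer 1 m n A) * var_v ^ card (layer 2 m n A))"

text \<open>Integer arguments, because the lower index \<open>p - 1\<close> may be \<open>-1\<close>, where the binomial
  coefficient vanishes; truncated subtraction on \<^typ>\<open>nat\<close> would give \<open>1\<close> instead.\<close>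

definition binom :: "int \<Rightarrow> int \<Rightarrow> int" where
  "binom a b = (if b < 0 \<or> b > a then 0 else int (nat a choose nat b))"

end

theory Submission
  imports Defs
begin

text \<open>An antichain of $[2]\times[m]\times[n]$ is a pair $(A, C)$ of antichains of
  $[m]\times[n]$ with no element of $A$ below an element of $C$. Peel off the rows
  $[m]\times\{j\}$ from $j = n$ downwards, removing first the element of $C$ and then that of $A$
  in the row, if there is one. What remains in smaller rows must have a larger first coordinate
  than anything removed from the same antichain, and the remaining part of $A$ must also have a
  larger first coordinate than anything removed from $C$. So the number of completions depends
  only on the number of rows left and on the numbers $a \le b$ of values left for the first
  coordinate in $A$ and $C$. It is a difference of two products, each of which solves the recursion
  away from the diagonal $a = b$; the second one is chosen so that the difference
  solves it on the diagonal too.\<close>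

section \<open>Antichains of a grid, row by row\<close>

text \<open>A row fixes the second coordinate. The excluded bound \<open>g\<close> records the
  largest first coordinate already ruled out, so \<open>r - g\<close> values remain.\<close>

definition strip :: "nat \<Rightarrow> nat \<Rightarrow> nat \<Rightarrow> (nat \<times> nat) set" where
  "strip r k g = {g<..r} \<times> {1..k}"

lemma finite_antichains: "finite P \<Longrightarrow> finite (antichains P)"
  by (rule finite_subset[of _ "Pow P"]) (auto simp: antichains_def)

lemma finite_antichains_strip [simp]: "finite (antichains (strip r k g))"
  by (intro finite_antichains) (simp add: strip_def)

lemma antichains_stripD:
  assumes "A \<in> antichains (strip r k g)"
  shows "finite A" "A \<subseteq> strip r k g"
proof -
  show "A \<subseteq> strip r k g" using assms by (simp add: antichains_def)
  then show "finite A" by (rule finite_subset) (simp add: strip_def)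
qed

text \<open>Every element of \<open>A\<close> lies in a lower row than \<open>(y, Suc k)\<close>, so
  it is incomparable to that point exactly when its first coordinate exceeds \<open>y\<close>. This
  moves the bound from \<open>g\<close> to \<open>y\<close>.\<close>

lemma antichains_insert_iff:
  assumes "A \<subseteq> strip r k g" "y \<in> {g<..r}"
  shows "insert (y, Suc k) A \<in> antichains (strip r (Suc k) g) \<longleftrightarrow> A \<in> antichains (strip r k y)"
proof
  assume *: "insert (y, Suc k) A \<in> antichains (strip r (Suc k) g)"
  have "x \<in> strip r k y" if "x \<in> A" for x
  proof -
    obtain x1 x2 where x: "x = (x1, x2)" by fastforce
    have "x2 \<le> k" "x1 \<le> r" "1 \<le> x2" using assms(1) that x by (auto simp: strip_def)
    moreover have "\<not> x \<le> (y, Suc k)"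
    proof -
      have "x \<noteq> (y, Suc k)" using x \<open>x2 \<le> k\<close> by auto
      then show ?thesis using * that unfolding antichains_def pairwise_def by auto
    qed
    ultimately show ?thesis using x by (auto simp: strip_def)
  qed
  then show "A \<in> antichains (strip r k y)"
    using * by (auto simp: antichains_def pairwise_insert)
next
  assume *: "A \<in> antichains (strip r k y)"
  have "\<not> x \<le> (y, Suc k) \<and> \<not> (y, Suc k) \<le> x" if "x \<in> A" for x
    using * that by (auto simp: antichains_def strip_def)
  moreover have "insert (y, Suc k) A \<subseteq> strip r (Suc k) g"
    using assms by (auto simp: strip_def)
  ultimately show "insert (y, Suc k) A \<in> antichains (strip r (Suc k) g)"
    using * by (auto simp: antichains_def pairwise_insert)
qed

lemma top_notin_strip: "A \<subseteq> strip r k g \<Longrightarrow> (y, Suc k) \<notin> A"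
  by (auto simp: strip_def)

text \<open>A row is a chain, so an antichain meets the top row in at most one point; the union is
  over that point.\<close>

lemma antichains_strip_Suc:
  "antichains (strip r (Suc k) g) = antichains (strip r k g) \<union>
     (\<Union>y\<in>{g<..r}. insert (y, Suc k) ` antichains (strip r k y))" (is "?L = ?R")
proof
  show "?L \<subseteq> ?R"
  proof
    fix A assume A: "A \<in> ?L"
    show "A \<in> ?R"
    proof (cases "\<exists>y. (y, Suc k) \<in> A")
      case True
      then obtain y where y: "(y, Suc k) \<in> A" by blast
      define B where "B = A - {(y, Suc k)}"
      have AB: "A = insert (y, Suc k) B" using y by (auto simp: B_def)
      have yr: "y \<in> {g<..r}" using A y by (auto simp: antichains_def strip_def)
      have "B \<subseteq> strip r k g"
      proof
        fix x assume x: "x \<in> B"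
        obtain x1 x2 where xx: "x = (x1, x2)" by fastforce
        have "x \<in> A" "x \<noteq> (y, Suc k)" using x by (auto simp: B_def)
        then have "\<not> x \<le> (y, Suc k) \<and> \<not> (y, Suc k) \<le> x"
          using A y by (auto simp: antichains_def pairwise_def)
        moreover have "x \<in> strip r (Suc k) g" using A \<open>x \<in> A\<close> by (auto simp: antichains_def)
        ultimately show "x \<in> strip r k g" using xx by (auto simp: strip_def)
      qed
      then have "B \<in> antichains (strip r k y)"
        using antichains_insert_iff yr A AB by blast
      then show ?thesis using AB yr by auto
    next
      case False
      then have "A \<subseteq> strip r k g"
        using A by (auto simp: antichains_def strip_def subset_iff le_Suc_eq)
      then show ?thesis using A by (auto simp: antichains_def)
    qed
  qed
next
  have "antichains (strip r k g) \<subseteq> ?L"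
    by (auto simp: antichains_def strip_def)
  moreover have "insert (y, Suc k) A \<in> ?L"
    if "y \<in> {g<..r}" "A \<in> antichains (strip r k y)" for y A
  proof -
    have "A \<subseteq> strip r k g"
      using that by (auto simp: antichains_def strip_def)
    then show ?thesis using antichains_insert_iff that by blast
  qed
  ultimately show "?R \<subseteq> ?L" by blast
qed

lemma sum_antichains_strip_Suc:
  fixes f :: "(nat \<times> nat) set \<Rightarrow> int"
  shows "(\<Sum>A\<in>antichains (strip r (Suc k) g). f A) =
    (\<Sum>A\<in>antichains (strip r k g). f A) +
    (\<Sum>y\<in>{g<..r}. \<Sum>A\<in>antichains (strip r k y). f (insert (y, Suc k) A))"
proof -
  \<comment> \<open>The top-row point can be read off from the enlarged set; this gives both
    injectivity of the insertion and disjointness of the union.\<close>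
  have top: "(z, Suc k) \<notin> A" if "A \<in> antichains (strip r k y)" for z y :: nat and A
    using that by (auto simp: antichains_def strip_def)
  have image: "(\<Sum>A\<in>insert (y, Suc k) ` antichains (strip r k y). f A) =
      (\<Sum>A\<in>antichains (strip r k y). f (insert (y, Suc k) A))" for y :: nat
  proof (subst sum.reindex)
    show "inj_on (insert (y, Suc k)) (antichains (strip r k y))"
      by (rule inj_onI) (metis top insert_ident)
  qed simp
  have "(\<Sum>A\<in>antichains (strip r (Suc k) g). f A) =
    (\<Sum>A\<in>antichains (strip r k g). f A) +
    (\<Sum>A\<in>(\<Union>y\<in>{g<..r}. insert (y, Suc k) ` antichains (strip r k y)). f A)"
    unfolding antichains_strip_Suc by (rule sum.union_disjoint) (use top in auto)
  also have "(\<Sum>A\<in>(\<Union>y\<in>{g<..r}. insert (y, Suc k) ` antichains (strip r k y)). f A) =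
    (\<Sum>y\<in>{g<..r}. \<Sum>A\<in>insert (y, Suc k) ` antichains (strip r k y). f A)"
  proof (rule sum.UNION_disjoint; (intro ballI impI)?)
    fix y z :: nat assume "y \<noteq> z"
    then show "insert (y, Suc k) ` antichains (strip r k y) \<inter>
        insert (z, Suc k) ` antichains (strip r k z) = {}"
      using top by blast
  qed auto
  finally show ?thesis by (simp only: image)
qed

section \<open>Recursions for pairs of antichains\<close>

text \<open>One-sided because a point of layer 2 is never below a point of layer 1.\<close>

definition below_free :: "'a::order set \<Rightarrow> 'a set \<Rightarrow> bool" where
  "below_free A C \<longleftrightarrow> (\<forall>x\<in>A. \<forall>y\<in>C. \<not> x \<le> y)"

text \<open>Separate row numbers \<open>k\<close> and \<open>l\<close> allow for the intermediate
  state in which \<open>C\<close> has lost its top row and \<open>A\<close> has not.\<close>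

definition pair_count :: "nat \<Rightarrow> nat \<Rightarrow> nat \<Rightarrow> nat \<Rightarrow> nat \<Rightarrow> nat \<Rightarrow> nat \<Rightarrow> int" where
  "pair_count r k l g h p q =
    (\<Sum>A\<in>antichains (strip r k g). \<Sum>C\<in>antichains (strip r l h).
       of_bool (card A = p \<and> card C = q \<and> below_free A C))"

text \<open>The new point of \<open>A\<close> is in a row above all of \<open>C\<close>, so it
  cannot lie below a point of \<open>C\<close> and only the bound for \<open>A\<close>
  changes.\<close>

lemma pair_count_Suc_left:
  "pair_count r (Suc k) k g h p q = pair_count r k k g h p q +
     (case p of 0 \<Rightarrow> 0 | Suc p' \<Rightarrow> \<Sum>y\<in>{g<..r}. pair_count r k k y h p' q)"
proof -
  have ins: "(of_bool (card (insert (y, Suc k) A) = p \<and> card C = q \<and>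
        below_free (insert (y, Suc k) A) C) :: int) =
      (case p of 0 \<Rightarrow> 0 | Suc p' \<Rightarrow> of_bool (card A = p' \<and> card C = q \<and> below_free A C))"
    if "A \<in> antichains (strip r k y)" "C \<in> antichains (strip r k h)" for y A C
  proof -
    have "card (insert (y, Suc k) A) = Suc (card A)"
      using antichains_stripD[OF that(1)] by (simp add: top_notin_strip)
    moreover have "below_free (insert (y, Suc k) A) C \<longleftrightarrow> below_free A C"
      using antichains_stripD(2)[OF that(2)] by (auto simp: below_free_def strip_def)
    ultimately show ?thesis by (simp split: nat.split)
  qed
  have "pair_count r (Suc k) k g h p q = pair_count r k k g h p q +
     (\<Sum>y\<in>{g<..r}. \<Sum>A\<in>antichains (strip r k y). \<Sum>C\<in>antichains (strip r k h).
       case p of 0 \<Rightarrow> 0 | Suc p' \<Rightarrow> of_bool (card A = p' \<and> card C = q \<and> below_free A C))"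
    unfolding pair_count_def sum_antichains_strip_Suc
    by (intro arg_cong2[where f = "(+)"] sum.cong refl ins)
  then show ?thesis by (cases p) (simp_all add: pair_count_def del: sum_of_bool_eq)
qed

text \<open>No point of \<open>A\<close> is in a row above that of the new point
  \<open>(y, Suc k)\<close> of \<open>C\<close>. So \<open>A\<close> avoids lying below it exactly
  when all its first coordinates exceed \<open>y\<close>, whence the bound
  \<open>max g y\<close>.\<close>

lemma pair_count_Suc_right:
  "pair_count r (Suc k) (Suc k) g h p q = pair_count r (Suc k) k g h p q +
     (case q of 0 \<Rightarrow> 0 | Suc q' \<Rightarrow> \<Sum>y\<in>{h<..r}. pair_count r (Suc k) k (max g y) y p q')"
proof -
  let ?X = "\<lambda>g. antichains (strip r (Suc k) g)"
  let ?w = "\<lambda>p q A C. of_bool (card A = p \<and> card C = q \<and> below_free A C) :: int"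
  have restrict: "{A \<in> ?X g. A \<subseteq> {y<..r} \<times> UNIV} = ?X (max g y)" for y
  proof -
    have "strip r (Suc k) g \<inter> {y<..r} \<times> UNIV = strip r (Suc k) (max g y)"
      by (auto simp: strip_def)
    then show ?thesis by (auto simp: antichains_def simp flip: \<open>_ = strip _ _ (max g y)\<close>)
  qed
  have ins: "?w p q A (insert (y, Suc k) C) =
      (case q of 0 \<Rightarrow> 0 | Suc q' \<Rightarrow> if A \<subseteq> {y<..r} \<times> UNIV then ?w p q' A C else 0)"
    if "A \<in> ?X g" "C \<in> antichains (strip r k y)" for y A C
  proof -
    have "card (insert (y, Suc k) C) = Suc (card C)"
      using antichains_stripD[OF that(2)] by (simp add: top_notin_strip)
    moreover have "below_free A (insert (y, Suc k) C) \<longleftrightarrow>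
        A \<subseteq> {y<..r} \<times> UNIV \<and> below_free A C"
      using antichains_stripD(2)[OF that(1)] by (fastforce simp: below_free_def strip_def)
    ultimately show ?thesis by (simp split: nat.split)
  qed
  have "pair_count r (Suc k) (Suc k) g h p q = pair_count r (Suc k) k g h p q +
     (\<Sum>A\<in>?X g. \<Sum>y\<in>{h<..r}. \<Sum>C\<in>antichains (strip r k y). ?w p q A (insert (y, Suc k) C))"
    unfolding pair_count_def
    by (simp only: sum_antichains_strip_Suc[where f = "?w p q _"] sum.distrib)
  also have "(\<Sum>A\<in>?X g. \<Sum>y\<in>{h<..r}. \<Sum>C\<in>antichains (strip r k y). ?w p q A (insert (y, Suc k) C)) =
     (\<Sum>y\<in>{h<..r}. \<Sum>A\<in>?X g. \<Sum>C\<in>antichains (strip r k y). ?w p q A (insert (y, Suc k) C))"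
    by (rule sum.swap)
  also have "\<dots> = (case q of 0 \<Rightarrow> 0 | Suc q' \<Rightarrow> \<Sum>y\<in>{h<..r}. pair_count r (Suc k) k (max g y) y p q')"
  proof (cases q)
    case 0
    then show ?thesis by (simp only: nat.case) (intro sum.neutral ballI, simp only: ins[unfolded 0] nat.case)
  next
    case (Suc q')
    have "(\<Sum>A\<in>?X g. \<Sum>C\<in>antichains (strip r k y). ?w p q A (insert (y, Suc k) C)) =
        pair_count r (Suc k) k (max g y) y p q'" for y
    proof -
      have "(\<Sum>A\<in>?X g. \<Sum>C\<in>antichains (strip r k y). ?w p q A (insert (y, Suc k) C)) =
          (\<Sum>A\<in>?X g. if A \<subseteq> {y<..r} \<times> UNIV
             then \<Sum>C\<in>antichains (strip r k y). ?w p q' A C else 0)"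
        by (intro sum.cong refl) (simp add: ins[unfolded Suc] Suc cong: sum.cong del: sum_of_bool_eq)
      also have "\<dots> = (\<Sum>A\<in>?X (max g y). \<Sum>C\<in>antichains (strip r k y). ?w p q' A C)"
        unfolding restrict[symmetric] by (rule sum.inter_filter[symmetric]) simp
      finally show ?thesis by (simp add: pair_count_def)
    qed
    then show ?thesis using Suc by simp
  qed
  finally show ?thesis .
qed

lemma pair_count_0: "pair_count r 0 0 g h p q = of_bool (p = 0 \<and> q = 0)"
proof -
  have "antichains (strip r 0 g) = {{}}" for g by (auto simp: antichains_def strip_def)
  then show ?thesis by (auto simp: pair_count_def below_free_def)
qed

section \<open>Closed formulas and the recursion in the first antichain\<close>

text \<open>$\binom{x-1}{k-1}$, zero for $k = 0$. For $x = 0$ truncated subtraction makes it differ from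
  $\binom{-1}{k-1}$, but below it is then multiplied by a vanishing factor whenever $a \le b$.\<close>

definition pred_binom :: "nat \<Rightarrow> nat \<Rightarrow> int" where
  "pred_binom x k = (case k of 0 \<Rightarrow> 0 | Suc j \<Rightarrow> int ((x - 1) choose j))"

lemma pred_binom_simps [simp]:
  "pred_binom x 0 = 0" "pred_binom x (Suc j) = int ((x - 1) choose j)"
  by (simp_all add: pred_binom_def)

lemma pred_binom_Suc: "x > 0 \<Longrightarrow> pred_binom (Suc x) (Suc k) = pred_binom x (Suc k) + pred_binom x k"
  by (cases x; cases k) auto

definition full_formula :: "nat \<Rightarrow> nat \<Rightarrow> nat \<Rightarrow> nat \<Rightarrow> nat \<Rightarrow> int" where
  "full_formula m a b p q =
     int (m choose p) * int (a choose p) * int (m choose q) * int (b choose q)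
     - pred_binom m p * int (Suc a choose Suc p) * int (Suc m choose Suc q) * pred_binom b q"

text \<open>The count when $A$ has one more row available than $C$.\<close>

definition half_formula :: "nat \<Rightarrow> nat \<Rightarrow> nat \<Rightarrow> nat \<Rightarrow> nat \<Rightarrow> int" where
  "half_formula m a b p q =
     int (Suc m choose p) * int (a choose p) * int (m choose q) * int (b choose q)
     - pred_binom (Suc m) p * int (Suc a choose Suc p) * int (Suc m choose Suc q) * pred_binom b q"

lemma sum_choose: "(\<Sum>k<a. int (k choose j)) = int (a choose Suc j)"
  by (induction a) auto

text \<open>The counterpart of \<open>pair_count_Suc_left\<close> with \<open>a' = r - y\<close>:
  hockey-stick summation in \<open>a\<close>, then Pascal's rule in \<open>m\<close>.\<close>

lemma half_formula_eq:
  "half_formula m a b p q = full_formula m a b p q +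
     (case p of 0 \<Rightarrow> 0 | Suc p' \<Rightarrow> \<Sum>a'<a. full_formula m a' b p' q)"
proof (cases p)
  case (Suc p')
  have shift: "pred_binom m p' * (\<Sum>x<a. int (Suc x choose Suc p')) =
      pred_binom m p' * int (Suc a choose Suc p)"
  proof (cases p')
    case (Suc j)
    have "(\<Sum>x<a. int (Suc x choose Suc p')) = int (Suc a choose Suc p)"
      using sum.lessThan_Suc_shift[of "\<lambda>k. int (k choose Suc p')" a] sum_choose[of "Suc p'" "Suc a"] \<open>p = Suc p'\<close>
      by (simp del: binomial_Suc_Suc sum.lessThan_Suc)
    then show ?thesis by simp
  qed simp
  have "(\<Sum>a'<a. full_formula m a' b p' q) =
      int (m choose p') * (\<Sum>x<a. int (x choose p')) * int (m choose q) * int (b choose q)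
      - (pred_binom m p' * (\<Sum>x<a. int (Suc x choose Suc p'))) * int (Suc m choose Suc q) * pred_binom b q"
    unfolding full_formula_def sum_subtractf sum_distrib_left sum_distrib_right by simp
  also have "\<dots> = int (m choose p') * int (a choose p) * int (m choose q) * int (b choose q)
      - pred_binom m p' * int (Suc a choose Suc p) * int (Suc m choose Suc q) * pred_binom b q"
    unfolding shift sum_choose Suc ..
  finally have *: "(\<Sum>a'<a. full_formula m a' b p' q) = \<dots>" .
  show ?thesis
  proof (cases "m = 0")
    \<comment> \<open>Pascal's rule for \<open>pred_binom\<close> may fail at 0, but for
      \<open>m = 0\<close> the product \<open>(Suc m choose Suc q) * pred_binom b q\<close>
      vanishes: its first factor for \<open>q > 0\<close>, its second for
      \<open>q = 0\<close>.\<close>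
    case True
    then show ?thesis using Suc * by (cases q) (simp_all add: half_formula_def full_formula_def)
  next
    case False
    have "int (Suc m choose p) = int (m choose p) + int (m choose p')" by (simp add: Suc)
    moreover have "pred_binom (Suc m) p = pred_binom m p + pred_binom m p'"
      using pred_binom_Suc False Suc by simp
    moreover have "(case p of 0 \<Rightarrow> 0 | Suc p' \<Rightarrow> \<Sum>a'<a. full_formula m a' b p' q) =
        (\<Sum>a'<a. full_formula m a' b p' q)" by (simp add: Suc)
    ultimately show ?thesis
      unfolding half_formula_def * by (simp add: full_formula_def algebra_simps del: binomial_Suc_Suc)
  qed
qed (simp add: half_formula_def full_formula_def)

section \<open>Summation for the second antichain and the diagonal\<close>

text \<open>The antidifference of \<open>half_formula\<close> in \<open>b\<close>: both lower
  indices belonging to \<open>b\<close> are raised by one.\<close>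

definition step_formula :: "nat \<Rightarrow> nat \<Rightarrow> nat \<Rightarrow> nat \<Rightarrow> nat \<Rightarrow> int" where
  "step_formula m a b p q =
     int (Suc m choose p) * int (a choose p) * int (m choose q) * int (b choose Suc q)
     - pred_binom (Suc m) p * int (Suc a choose Suc p) * int (Suc m choose Suc q) * pred_binom b (Suc q)"

lemma step_formula_Suc:
  assumes "a \<le> b"
  shows "step_formula m a (Suc b) p q = step_formula m a b p q + half_formula m a b p q"
proof (cases "b = 0")
  \<comment> \<open>Pascal's rule for \<open>pred_binom\<close> may fail at 0, but now
    \<open>a = 0\<close>, and \<open>pred_binom (Suc m) p * (Suc a choose Suc p)\<close> vanishes
    for every \<open>p\<close>.\<close>
  case True
  then show ?thesis using assms by (cases p; cases q) (simp_all add: step_formula_def half_formula_def)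
next
  case False
  then have "pred_binom (Suc b) (Suc q) = pred_binom b (Suc q) + pred_binom b q"
    by (rule pred_binom_Suc[OF neq0_conv[THEN iffD1]])
  moreover have "int (Suc b choose Suc q) = int (b choose Suc q) + int (b choose q)" by simp
  ultimately show ?thesis
    unfolding step_formula_def half_formula_def by (simp add: algebra_simps del: binomial_Suc_Suc)
qed

text \<open>After multiplication by \<open>Suc p * Suc q\<close>, absorption turns both sides into
  \<open>Suc m * Suc a\<close> times the four binomials of \<open>m\<close> and \<open>a\<close>
  over \<open>p\<close> and \<open>q\<close>.\<close>

lemma binomial_absorption_quadruple:
  "(Suc m choose Suc p) * (m choose q) * (a choose p) * (Suc a choose Suc q) =
   (m choose p) * (Suc m choose Suc q) * (Suc a choose Suc p) * (a choose q)" (is "?L = ?R")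
proof -
  have "(Suc p * Suc q) * ?L =
      (Suc p * (Suc m choose Suc p)) * (Suc q * (Suc a choose Suc q)) * (m choose q) * (a choose p)"
    by (simp only: ac_simps)
  also have "\<dots> = (Suc q * (Suc m choose Suc q)) * (Suc p * (Suc a choose Suc p)) * (m choose p) * (a choose q)"
    unfolding Suc_times_binomial by (simp only: ac_simps)
  also have "\<dots> = (Suc p * Suc q) * ?R" by (simp only: ac_simps)
  finally show ?thesis by (simp only: mult_cancel1) simp
qed

text \<open>Raising \<open>a\<close> to \<open>Suc a\<close> changes both products by the same
  amount, by the absorption identity. This is the condition on the diagonal that the second product
  is made to satisfy.\<close>

lemma step_formula_Suc_diag:
  "step_formula m (Suc a) (Suc a) p q = step_formula m a (Suc a) p q"
proof (cases p)
  case (Suc j)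
  have "int (Suc m choose p) * int (m choose q) * int (a choose j) * int (Suc a choose Suc q) =
      int (m choose j) * int (Suc m choose Suc q) * int (Suc a choose p) * int (a choose q)"
    using binomial_absorption_quadruple[of m j q a] unfolding Suc of_nat_mult[symmetric] by simp
  moreover have "int (Suc a choose p) = int (a choose p) + int (a choose j)" by (simp add: Suc)
  moreover have "int (Suc (Suc a) choose Suc p) = int (Suc a choose Suc p) + int (Suc a choose p)" by simp
  moreover have "pred_binom (Suc m) p = int (m choose j)" "pred_binom (Suc a) (Suc q) = int (a choose q)"
    by (simp_all add: Suc)
  ultimately show ?thesis unfolding step_formula_def by (simp add: algebra_simps del: binomial_Suc_Suc)
qed (simp add: step_formula_def)

text \<open>Passing from \<open>b\<close> to \<open>Suc b\<close> first raises \<open>b\<close> with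
  \<open>min a b\<close> fixed, which adds the new summand. If \<open>a > b\<close>, the minimum
  then grows too, and the diagonal identity makes that free.\<close>

lemma sum_half_formula: "(\<Sum>b'<b. half_formula m (min a b') b' p q) = step_formula m (min a b) b p q"
proof (induction b)
  case 0
  then show ?case by (cases p; cases q) (simp_all add: step_formula_def)
next
  case (Suc b)
  have "step_formula m (min a (Suc b)) (Suc b) p q = step_formula m (min a b) (Suc b) p q"
  proof (cases "a \<le> b")
    case False
    then have "min a (Suc b) = Suc b" "min a b = b" by auto
    then show ?thesis by (simp only: step_formula_Suc_diag)
  qed simp
  then show ?case using Suc step_formula_Suc[of "min a b" b m p q] by simp
qed

text \<open>The counterpart of \<open>pair_count_Suc_right\<close>. As \<open>a \<le> b\<close>, the
  sum is \<open>step_formula m a b\<close>, and Pascal's rule in \<open>m\<close> combines it with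
  \<open>half_formula\<close>.\<close>

lemma full_formula_Suc:
  assumes "a \<le> b"
  shows "full_formula (Suc m) a b p q = half_formula m a b p q +
     (case q of 0 \<Rightarrow> 0 | Suc q' \<Rightarrow> \<Sum>b'<b. half_formula m (min a b') b' p q')"
proof (cases q)
  case (Suc j)
  have "int (Suc m choose q) = int (m choose q) + int (m choose j)"
    "int (Suc (Suc m) choose Suc q) = int (Suc m choose Suc q) + int (Suc m choose q)"
    by (simp_all add: Suc)
  moreover have "(case q of 0 \<Rightarrow> 0 | Suc q' \<Rightarrow> \<Sum>b'<b. half_formula m (min a b') b' p q') =
      step_formula m a b p j"
    using assms by (simp add: Suc sum_half_formula min_absorb1)
  ultimately show ?thesis
    by (simp add: full_formula_def half_formula_def step_formula_def Suc algebra_simps del: binomial_Suc_Suc)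
qed (simp add: full_formula_def half_formula_def)

section \<open>Closed form of the pair count\<close>

lemma sum_reflect: "(\<Sum>y\<in>{g<..r}. f (r - y)) = (\<Sum>x<r - g. f x)" for f :: "nat \<Rightarrow> int"
  by (rule sum.reindex_bij_witness[of _ "\<lambda>x. r - x" "\<lambda>y. r - y"]) auto

text \<open>Reflection replaces a removed position \<open>y\<close> by the number
  \<open>r - y\<close> of values left, turning \<open>max g y\<close> into a minimum. The invariant
  \<open>h \<le> g\<close> becomes \<open>a \<le> b\<close> and survives both removals.\<close>

lemma pair_count_eq_full_formula:
  "h \<le> g \<Longrightarrow> g \<le> r \<Longrightarrow> pair_count r m m g h p q = full_formula m (r - g) (r - h) p q"
proof (induction m arbitrary: g h p q)
  case 0
  then show ?case by (cases p; cases q) (auto simp: pair_count_0 full_formula_def)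
next
  case (Suc m)
  have left: "pair_count r (Suc m) m g h p q = half_formula m (r - g) (r - h) p q"
    if "h \<le> g" "g \<le> r" for g h p q
  proof -
    have "(\<Sum>y\<in>{g<..r}. pair_count r m m y h p' q) = (\<Sum>x<r - g. full_formula m x (r - h) p' q)" for p'
      unfolding sum_reflect[symmetric] by (rule sum.cong) (use that Suc.IH in auto)
    then show ?thesis
      using Suc.IH[OF that] by (cases p) (simp_all add: pair_count_Suc_left half_formula_eq)
  qed
  have "(\<Sum>y\<in>{h<..r}. pair_count r (Suc m) m (max g y) y p q') =
      (\<Sum>x<r - h. half_formula m (min (r - g) x) x p q')" for q'
    unfolding sum_reflect[symmetric]
  proof (rule sum.cong)
    fix y assume "y \<in> {h<..r}"
    moreover have "r - max g y = min (r - g) (r - y)" by auto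
    ultimately show "pair_count r (Suc m) m (max g y) y p q' =
        half_formula m (min (r - g) (r - y)) (r - y) p q'"
      using left Suc.prems by simp
  qed simp
  then show ?case
    using left[OF Suc.prems] Suc.prems
    by (cases q) (simp_all add: pair_count_Suc_right full_formula_Suc)
qed

section \<open>From the polynomial to pairs of antichains\<close>

lemma coeff_uv_antichain_poly:
  "coeff_uv (antichain_poly m n) p q =
    (\<Sum>A\<in>antichains (chain_product m n).
       of_bool (card (layer 1 m n A) = p \<and> card (layer 2 m n A) = q))"
proof -
  have u: "var_u ^ i = [:monom 1 i:]" for i
    by (induction i) (simp_all add: var_u_def monom_Suc one_pCons)
  have v: "var_v ^ j = monom 1 j" for j
    by (simp add: var_v_def monom_altdef)
  have "coeff_uv (var_u ^ i * var_v ^ j) p q = of_bool (i = p \<and> j = q)" for i j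
    by (auto simp: u v coeff_uv_def)
  then show ?thesis
    by (simp add: antichain_poly_def coeff_uv_def coeff_sum)
qed

lemma layered_antichain_iff:
  "Pair (1::nat) ` A \<union> Pair 2 ` C \<in> antichains (chain_product m n) \<longleftrightarrow>
    A \<in> antichains (strip m n 0) \<and> C \<in> antichains (strip m n 0) \<and> below_free A C"
proof -
  let ?R = "\<lambda>x y. \<not> x \<le> y \<and> \<not> y \<le> x"
  have "Pair (1::nat) ` A \<union> Pair 2 ` C \<subseteq> chain_product m n \<longleftrightarrow>
      A \<subseteq> strip m n 0 \<and> C \<subseteq> strip m n 0"
    by (auto simp: chain_product_def strip_def subset_iff Suc_le_eq image_iff)
  moreover have "pairwise ?R (Pair (1::nat) ` A \<union> Pair 2 ` C) \<longleftrightarrow>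
      pairwise ?R A \<and> pairwise ?R C \<and> below_free A C"
    unfolding pairwise_def below_free_def ball_Un ball_simps by simp blast
  ultimately show ?thesis unfolding antichains_def by blast
qed

text \<open>Cutting an antichain into its two layers is a bijection onto the pairs satisfying
  \<open>below_free\<close>; the other pairs contribute 0. First coordinates range up to
  \<open>m\<close>, and there are \<open>n\<close> rows.\<close>

lemma coeff_uv_antichain_poly_eq_pair_count:
  "coeff_uv (antichain_poly m n) p q = pair_count m n n 0 0 p q"
proof -
  let ?S = "antichains (strip m n 0)"
  have layers: "layer 1 m n (Pair 1 ` A \<union> Pair 2 ` C) = Pair 1 ` A"
    "layer 2 m n (Pair 1 ` A \<union> Pair 2 ` C) = Pair 2 ` C"
    if "A \<in> ?S" "C \<in> ?S" for A C
    using that[THEN antichains_stripD(2)] by (fastforce simp: layer_def strip_def)+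
  have split: "Pair 1 ` (Pair 1 -` A) \<union> Pair 2 ` (Pair 2 -` A) = A"
    if "A \<in> antichains (chain_product m n)" for A
  proof -
    have "i = 1 \<or> i = 2" if "(i, x) \<in> A" for i x
      using that \<open>A \<in> _\<close> by (fastforce simp: antichains_def chain_product_def)
    then show ?thesis by force
  qed
  have "pair_count m n n 0 0 p q =
      (\<Sum>(A, C)\<in>?S \<times> ?S. of_bool (card A = p \<and> card C = q \<and> below_free A C))"
    by (simp only: pair_count_def sum.cartesian_product)
  also have "\<dots> = (\<Sum>(A, C)\<in>{(A, C). A \<in> ?S \<and> C \<in> ?S \<and> below_free A C}.
      of_bool (card A = p \<and> card C = q))"
    by (rule sum.mono_neutral_cong_right) auto
  also have "\<dots> = (\<Sum>A\<in>antichains (chain_product m n).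
       of_bool (card (layer 1 m n A) = p \<and> card (layer 2 m n A) = q))"
  proof (rule sum.reindex_bij_witness[of _ "\<lambda>A. (Pair 1 -` A, Pair 2 -` A)"
        "\<lambda>(A, C). Pair 1 ` A \<union> Pair 2 ` C"])
    fix X assume X: "X \<in> antichains (chain_product m n)"
    then show "(\<lambda>(A, C). Pair 1 ` A \<union> Pair 2 ` C) (Pair 1 -` X, Pair 2 -` X) = X"
      using split by simp
    show "(Pair 1 -` X, Pair 2 -` X) \<in> {(A, C). A \<in> ?S \<and> C \<in> ?S \<and> below_free A C}"
      using X split[OF X] layered_antichain_iff[of "Pair 1 -` X" "Pair 2 -` X"] by simp
  next
    fix X assume "X \<in> {(A, C). A \<in> ?S \<and> C \<in> ?S \<and> below_free A C}"
    then obtain A C where X: "X = (A, C)" "A \<in> ?S" "C \<in> ?S" "below_free A C" by blast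
    let ?Y = "(\<lambda>(A, C). Pair (1::nat) ` A \<union> Pair 2 ` C) X"
    show "(Pair 1 -` ?Y, Pair 2 -` ?Y) = X" by (auto simp: X(1))
    show "?Y \<in> antichains (chain_product m n)"
      using X layered_antichain_iff[of A C] by simp
    show "of_bool (card (layer 1 m n ?Y) = p \<and> card (layer 2 m n ?Y) = q) =
        (case X of (A, C) \<Rightarrow> of_bool (card A = p \<and> card C = q))"
      unfolding X(1) prod.case layers[OF X(2,3)] by (simp add: card_image inj_on_def)
  qed
  finally show ?thesis using coeff_uv_antichain_poly by simp
qed

theorem theorem3p5:
  fixes m n p q :: nat
  assumes "m > 0" and "n > 0"
  shows "coeff_uv (antichain_poly m n) p q =
    binom (int m) (int p) * binom (int n) (int p) * binom (int m) (int q) * binom (int n) (int q)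
    - binom (int m + 1) (int p + 1) * binom (int n - 1) (int p - 1)
      * binom (int m - 1) (int q - 1) * binom (int n + 1) (int q + 1)"
proof -
  have nat: "binom (int x) (int k) = int (x choose k)" for x k
    by (auto simp: binom_def binomial_eq_0)
  have suc: "binom (int x + 1) (int k + 1) = int (Suc x choose Suc k)" for x k
    using nat[of "Suc x" "Suc k"] by (simp add: add.commute)
  \<comment> \<open>Positivity matters here: at \<open>x = 0\<close>, \<open>k = 1\<close> the left
    side is 0 and the right side is 1.\<close>
  have pred: "binom (int x - 1) (int k - 1) = pred_binom x k" if "x > 0" for x k
    using that nat[of "x - 1" "k - 1"] by (cases k) (simp_all add: binom_def)
  show ?thesis
    \<comment> \<open>With \<open>n\<close> rows and all \<open>m\<close> values free in both
      antichains, the count is \<open>full_formula n m m p q\<close>.\<close>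
    unfolding coeff_uv_antichain_poly_eq_pair_count nat suc pred[OF assms(1)] pred[OF assms(2)]
    by (subst pair_count_eq_full_formula) (simp_all add: full_formula_def ac_simps)
qed

end
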